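(* Assume $\eta(\xi_0^{(0)}=0)=1$. Let $A=\{\bar\xi: \{Z_n(\bar\xi)\}\text{ is }\bar\xi\text{-regular}\}$. Then $\eta(A)=0$ or $\eta(A)=1$.
   Context: Setting. $\bar\xi=\{\xi_n:n\in\mathbb Z\}$ is an i.i.d. sequence of random probability distributions $\xi_n=\{\xi_n^{(0)},\xi_n^{(1)},\dots\}$ on the nonnegative integers; the law of the environment $\bar\xi$ is $\eta$. Given $\bar\xi$, $Z_0=1$ and $Z_n=Z_n(\bar\xi)$ is the sum of $Z_{n-1}$ independent random variables each with distribution $\xi_{n-1}$. $P_{\bar\xi}$ is the (quenched) probability for fixed $\bar\xi$. Notation. $f_{\xi_i}(s)=\sum_{j\ge0}\xi_i^{(j)}s^j$ and $f_{\xi_i}^{(-1)}$ is its inverse function. For $0<s<\infty$, $h_{\xi_i}(s)=-\log f_{\xi_i}^{(-1)}(e^{-s})$ and $h_n(\bar\xi,s)=h_{\xi_{n-1}}(\cdots(h_{\xi_0}(s))\cdots)$. For each $s\in(0,\infty)$, $W(\bar\xi,s)\in[0,\infty]$ is the almost sure limit of $Z_n(\bar\xi)h_n(\bar\xi,s)$ as $n\to\infty$ (this limit exists almost surely). Definitions. A point $s\in(0,\infty)$ is called $\bar\xi$-regular if $P_{\bar\xi}(W(\bar\xi,s)\in\{0,\infty\})=1$, and $\bar\xi$-irregular otherwise. The process $\{Z_n(\bar\xi)\}$ is called $\bar\xi$-regular if all $s\in(0,\infty)$ are $\bar\xi$-regular, and $\bar\xi$-irregular otherwise. *)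

theory Defs
  imports "HOL-Probability.Probability"
begin

(* The space of probability distributions on the nonnegative integers, with the smallest
   sigma-algebra making every coefficient p \<mapsto> pmf p j measurable. *)
definition offspring_space :: "nat pmf measure" where
  "offspring_space = vimage_algebra UNIV pmf (\<Pi>\<^sub>M j\<in>UNIV. (borel :: real measure))"

definition environment_space :: "(int \<Rightarrow> nat pmf) measure" where
  "environment_space = (\<Pi>\<^sub>M n\<in>UNIV. offspring_space)"

(* A sample point x of the quenched space lists the offspring numbers: x (n, i) is the number
   of children of the i-th individual of generation n, should there be one. *)
definition quenched :: "(int \<Rightarrow> nat pmf) \<Rightarrow> (nat \<times> nat \<Rightarrow> nat) measure" where
  "quenched \<xi> = (\<Pi>\<^sub>M k\<in>UNIV. measure_pmf (\<xi> (int (fst k))))"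

primrec Z :: "nat \<Rightarrow> (nat \<times> nat \<Rightarrow> nat) \<Rightarrow> nat" where
  "Z 0 x = 1"
| "Z (Suc n) x = (\<Sum>i<Z n x. x (n, i))"

definition pgf :: "nat pmf \<Rightarrow> real \<Rightarrow> real" where
  "pgf p s = (\<Sum>j. pmf p j * s ^ j)"

(* If pmf p 0 = 0, then pgf p is an increasing bijection of {0..1} onto itself. Otherwise
   exp (- s) may lie outside the range and the value of h is then unspecified. *)
definition h :: "nat pmf \<Rightarrow> real \<Rightarrow> real" where
  "h p s = - ln (inv_into {0..1} (pgf p) (exp (- s)))"

primrec h_iter :: "nat \<Rightarrow> (int \<Rightarrow> nat pmf) \<Rightarrow> real \<Rightarrow> real" where
  "h_iter 0 \<xi> s = s"
| "h_iter (Suc n) \<xi> s = h (\<xi> (int n)) (h_iter n \<xi> s)"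

(* If all offspring distributions in \<xi> have no mass at 0 and s > 0, the limit exists for
   almost every x with respect to quenched \<xi>; elsewhere its value is unspecified. *)
definition W :: "(int \<Rightarrow> nat pmf) \<Rightarrow> real \<Rightarrow> (nat \<times> nat \<Rightarrow> nat) \<Rightarrow> ereal" where
  "W \<xi> s x = lim (\<lambda>n. ereal (real (Z n x) * h_iter n \<xi> s))"

definition regular_point :: "(int \<Rightarrow> nat pmf) \<Rightarrow> real \<Rightarrow> bool" where
  "regular_point \<xi> s \<longleftrightarrow> \<P>(x in quenched \<xi>. W \<xi> s x \<in> {0, \<infinity>}) = 1"

definition regular_process :: "(int \<Rightarrow> nat pmf) \<Rightarrow> bool" where
  "regular_process \<xi> \<longleftrightarrow> (\<forall>s>0. regular_point \<xi> s)"

end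

theory Submission
  imports Defs
begin

text \<open>
  Write \<open>F\<^sub>n\<close> for the composition of the first \<open>n\<close> generating functions and
  \<open>u\<^sub>n = exp (- h\<^sub>n(s))\<close>, so that \<open>F\<^sub>n(u\<^sub>n) = exp (- s)\<close>. Then \<open>u\<^sub>n ^ Z\<^sub>n\<close> is a martingale with
  values in the unit interval and limit \<open>Y = exp (- W)\<close>. Its mean is \<open>exp (- s)\<close> and its second moment is the
  limit of \<open>F\<^sub>n(u\<^sub>n\<^sup>2)\<close>, and \<open>s\<close> is regular iff \<open>Y\<close> only takes the values 0 and 1, that is, iff the
  two agree. This turns regularity of the process into a condition on the functions \<open>F\<^sub>n\<close> which
  is monotone in \<open>s\<close>, hence decided by rational parameters and measurable, and which is
  invariant under the shift of the environment because \<open>F\<^sub>n\<^sub>+\<^sub>1\<close> is \<open>F\<^sub>n\<close> of the shifted environment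
  followed by a bijection of the unit interval. Kolmogorov's 0-1 law applies.
\<close>

section \<open>Generating functions\<close>

lemma summable_pgf:
  assumes "0 \<le> s" "s \<le> 1"
  shows "summable (\<lambda>j. pmf p j * s ^ j)"
proof (rule summable_comparison_test')
  show "summable (pmf p)"
    using integrable_pmf[of UNIV p] by (simp add: integrable_count_space_nat_iff)
  show "norm (pmf p j * s ^ j) \<le> pmf p j" if "0 \<le> j" for j
    using assms by (simp add: abs_mult mult_left_le power_le_one)
qed

lemma pgf_eq_expectation:
  assumes "0 \<le> s" "s \<le> 1"
  shows "pgf p s = (\<integral>k. s ^ k \<partial>measure_pmf p)"
proof -
  have "integrable (count_space UNIV) (\<lambda>j. pmf p j * s ^ j)"
    using summable_pgf[OF assms, of p] assms
    by (simp add: integrable_count_space_nat_iff abs_mult)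
  then show ?thesis
    unfolding measure_pmf_eq_density pgf_def
    by (subst integral_density) (auto simp: integral_count_space_nat)
qed

lemma pgf_bounds:
  assumes "0 \<le> s" "s \<le> 1"
  shows "0 \<le> pgf p s" "pgf p s \<le> 1"
proof -
  show "0 \<le> pgf p s"
    unfolding pgf_def using assms by (intro suminf_nonneg summable_pgf) auto
  have "(\<integral>k. s ^ k \<partial>measure_pmf p) \<le> (\<integral>k. 1 \<partial>measure_pmf p)"
    using assms by (intro integral_mono measure_pmf.integrable_const_bound[where B=1])
      (auto simp: power_le_one)
  then show "pgf p s \<le> 1"
    using assms by (simp add: pgf_eq_expectation)
qed

lemma pgf_0: "pgf p 0 = pmf p 0"
  using suminf_finite[of "{0}" "\<lambda>j. pmf p j * 0 ^ j"] by (simp add: pgf_def)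

lemma pgf_1: "pgf p 1 = 1"
  by (simp add: pgf_eq_expectation)

text \<open>The M-test with the masses as majorants gives uniform convergence on the closed
  interval, so continuity includes the endpoint 1.\<close>

lemma continuous_on_pgf: "continuous_on {0..1} (pgf p)"
  unfolding pgf_def
proof (rule uniform_limit_theorem[OF _ Weierstrass_m_test[where M="pmf p"]])
  show "\<forall>\<^sub>F n in sequentially. continuous_on {0..1} (\<lambda>s. \<Sum>i<n. pmf p i * s ^ i)"
    by (intro always_eventually allI continuous_intros)
  show "norm (pmf p j * s ^ j) \<le> pmf p j" if "s \<in> {0..1}" for j s
    using that by (simp add: abs_mult mult_left_le power_le_one)
  show "summable (pmf p)"
    using integrable_pmf[of UNIV p] by (simp add: integrable_count_space_nat_iff)
qed simp

lemma pgf_mono: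
  assumes "0 \<le> s" "s \<le> r" "r \<le> 1"
  shows "pgf p s \<le> pgf p r"
  unfolding pgf_def using assms
  by (intro suminf_le summable_pgf mult_left_mono power_mono) auto

text \<open>Without mass at 0 some positive exponent \<open>k\<close> carries mass; its monomial
  increases strictly while all others increase weakly.\<close>

lemma pgf_strict_mono:
  assumes "pmf p 0 = 0" "0 \<le> s" "s < r" "r \<le> 1"
  shows "pgf p s < pgf p r"
proof -
  obtain k where k: "k \<in> set_pmf p"
    using set_pmf_not_empty by fast
  then have "pmf p k > 0" "k \<noteq> 0"
    using assms(1) by (auto simp: pmf_positive set_pmf_iff intro: gr0I)
  then have "0 < pmf p k * r ^ k - pmf p k * s ^ k"
    using assms by (simp add: power_strict_mono)
  moreover have "0 \<le> pmf p j * r ^ j - pmf p j * s ^ j" for j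
    using assms by (simp add: mult_left_mono power_mono)
  ultimately have "0 < (\<Sum>j. pmf p j * r ^ j - pmf p j * s ^ j)"
    using assms by (intro suminf_pos2[where i=k] summable_diff summable_pgf) auto
  also have "\<dots> = pgf p r - pgf p s"
    using assms unfolding pgf_def by (intro suminf_diff[symmetric] summable_pgf) auto
  finally show ?thesis by simp
qed

lemma pgf_less_iff:
  assumes "pmf p 0 = 0" "s \<in> {0..1}" "r \<in> {0..1}"
  shows "pgf p s < pgf p r \<longleftrightarrow> s < r"
  using pgf_strict_mono[OF assms(1), of s r] pgf_mono[of r s p] assms by force

lemma pgf_preimage:
  assumes "pmf p 0 = 0" "0 < t" "t < 1"
  obtains s where "0 < s" "s < 1" "pgf p s = t"
proof -
  obtain s where s: "0 \<le> s" "s \<le> 1" "pgf p s = t"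
    using IVT'[of "pgf p" 0 t 1] assms continuous_on_pgf by (auto simp: pgf_0 pgf_1)
  moreover have "s \<noteq> 0" "s \<noteq> 1"
    using s assms pgf_0[of p] pgf_1[of p] by auto
  ultimately show thesis using that[of s] by auto
qed

text \<open>\<open>inv_into\<close> is meaningful only on the image, and \<open>pgf_preimage\<close>
  puts \<open>exp (- s)\<close> there. The values of \<open>pgf p\<close> at 0 and 1 keep the
  preimage off both endpoints, so its logarithm is negative.\<close>

lemma exp_neg_h:
  assumes "pmf p 0 = 0" "0 < s"
  shows "pgf p (exp (- h p s)) = exp (- s)" "0 < h p s"
proof -
  let ?u = "inv_into {0..1} (pgf p) (exp (- s))"
  obtain u where "0 < u" "u < 1" "pgf p u = exp (- s)"
    using pgf_preimage[of p "exp (- s)"] assms by auto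
  then have "exp (- s) \<in> pgf p ` {0..1}" by (intro image_eqI[of _ _ u]) auto
  then have u: "?u \<in> {0..1}" "pgf p ?u = exp (- s)"
    by (simp_all only: inv_into_into f_inv_into_f)
  then have "?u \<noteq> 0" "?u \<noteq> 1"
    using assms pgf_0[of p] pgf_1[of p] by (metis exp_not_eq_zero, auto)
  then have "0 < ?u" "?u < 1" using u by auto
  then show "0 < h p s" "pgf p (exp (- h p s)) = exp (- s)"
    using u by (simp_all add: h_def)
qed

text \<open>The youngest generation is applied innermost; in this order the composition is the
  generating function of \<open>Z n\<close>, see \<open>expectation_power_Z\<close>.\<close>

primrec pgf_iter :: "nat \<Rightarrow> (int \<Rightarrow> nat pmf) \<Rightarrow> real \<Rightarrow> real" where
  "pgf_iter 0 e s = s"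
| "pgf_iter (Suc n) e s = pgf_iter n e (pgf (e (int n)) s)"

lemma pgf_iter_bounds:
  assumes "0 \<le> s" "s \<le> 1"
  shows "0 \<le> pgf_iter n e s" "pgf_iter n e s \<le> 1"
  using assms by (induction n arbitrary: s) (auto simp: pgf_bounds)

lemma pgf_iter_less_iff:
  assumes "\<And>n. pmf (e (int n)) 0 = 0" "s \<in> {0..1}" "r \<in> {0..1}"
  shows "pgf_iter n e s < pgf_iter n e r \<longleftrightarrow> s < r"
  using assms by (induction n arbitrary: s r) (auto simp: pgf_bounds pgf_less_iff)

lemma continuous_on_pgf_iter: "continuous_on {0..1} (pgf_iter n e)"
proof (induction n)
  case (Suc n)
  have "continuous_on {0..1} (\<lambda>s. pgf_iter n e (pgf (e (int n)) s))"
    by (rule continuous_on_compose2[OF Suc continuous_on_pgf]) (auto simp: pgf_bounds)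
  then show ?case by simp
qed (simp add: continuous_on_id)

definition env_shift :: "nat \<Rightarrow> (int \<Rightarrow> 'a) \<Rightarrow> int \<Rightarrow> 'a" where
  "env_shift k e n = e (n + int k)"

text \<open>The recursion grows at the innermost function, whereas a shift of the environment
  removes the outermost one, which is split off here.\<close>

lemma pgf_iter_shift: "pgf_iter (Suc n) e s = pgf (e 0) (pgf_iter n (env_shift 1 e) s)"
  by (induction n arbitrary: s) (auto simp: env_shift_def ac_simps)

text \<open>The second fact will give the martingale its constant mean, the third its one-step
  property.\<close>

lemma exp_neg_h_iter:
  assumes "\<And>n. pmf (e (int n)) 0 = 0" "0 < s"
  shows "0 < h_iter n e s" "pgf_iter n e (exp (- h_iter n e s)) = exp (- s)"
    "pgf (e (int n)) (exp (- h_iter (Suc n) e s)) = exp (- h_iter n e s)"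
proof -
  show pos: "0 < h_iter n e s" for n
    using assms by (induction n) (auto intro: exp_neg_h)
  show step: "pgf (e (int n)) (exp (- h_iter (Suc n) e s)) = exp (- h_iter n e s)" for n
    using exp_neg_h[OF assms(1) pos] by simp
  show "pgf_iter n e (exp (- h_iter n e s)) = exp (- s)"
    by (induction n) (use step in auto)
qed

section \<open>Almost sure convergence of bounded martingales\<close>

text \<open>The martingale property is expressed without conditional expectations: it is tested
  against bounded measurable functions determined pointwise by \<open>X 0\<close>, ...,
  \<open>X n\<close>.\<close>

locale bounded_martingale = prob_space +
  fixes X :: "nat \<Rightarrow> 'a \<Rightarrow> real"
  assumes measurable_X[measurable]: "X n \<in> borel_measurable M"
    and X_bounded: "\<bar>X n x\<bar> \<le> 1"
    and martingale: "Y \<in> borel_measurable M \<Longrightarrow> (\<And>x. \<bar>Y x\<bar> \<le> B) \<Longrightarrow>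
      (\<And>x y. x \<in> space M \<Longrightarrow> y \<in> space M \<Longrightarrow> (\<And>i. i \<le> n \<Longrightarrow> X i x = X i y) \<Longrightarrow> Y x = Y y) \<Longrightarrow>
      (\<integral>x. Y x * X (Suc n) x \<partial>M) = (\<integral>x. Y x * X n x \<partial>M)"
begin

lemma integrable_bounded:
  fixes f :: "'a \<Rightarrow> real"
  assumes "f \<in> borel_measurable M" "\<And>x. \<bar>f x\<bar> \<le> B"
  shows "integrable M f"
  using assms by (intro integrable_const_bound[of _ B]) auto

lemma integrable_X_power: "integrable M (\<lambda>x. X n x ^ k)"
  using X_bounded by (intro integrable_bounded[where B=1]) (auto simp: power_abs power_le_one)

lemma martingale_le:
  assumes "n \<le> m" and [measurable]: "Y \<in> borel_measurable M" and "\<And>x. \<bar>Y x\<bar> \<le> B"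
    and Y: "\<And>x y. x \<in> space M \<Longrightarrow> y \<in> space M \<Longrightarrow> (\<And>i. i \<le> n \<Longrightarrow> X i x = X i y) \<Longrightarrow> Y x = Y y"
  shows "(\<integral>x. Y x * X m x \<partial>M) = (\<integral>x. Y x * X n x \<partial>M)"
  using \<open>n \<le> m\<close>
proof (induction rule: dec_induct)
  case (step k)
  have "(\<integral>x. Y x * X (Suc k) x \<partial>M) = (\<integral>x. Y x * X k x \<partial>M)"
  proof (rule martingale)
    show "Y x = Y y" if "x \<in> space M" "y \<in> space M" "\<And>i. i \<le> k \<Longrightarrow> X i x = X i y" for x y
      using that step.hyps(1) by (intro Y) auto
  qed (use assms in auto)
  then show ?case using step.IH by simp
qed simp

lemma X_diff_le: "\<bar>X m x - X n x\<bar> \<le> 2"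
  using X_bounded[of m x] X_bounded[of n x] by linarith

lemma X_diff_power2_le: "(X m x - X n x)\<^sup>2 \<le> 4"
  using power_mono[OF X_diff_le[of m x n], of 2] by simp

text \<open>Orthogonality of increments: testing with \<open>X n\<close> itself turns the mixed
  moment of \<open>X n\<close> and \<open>X m\<close> into the second moment of
  \<open>X n\<close>.\<close>

lemma expectation_increment:
  assumes "n \<le> m"
  shows "(\<integral>x. (X m x - X n x)\<^sup>2 \<partial>M) = (\<integral>x. (X m x)\<^sup>2 \<partial>M) - (\<integral>x. (X n x)\<^sup>2 \<partial>M)"
proof -
  have eq: "(\<integral>x. X n x * X m x \<partial>M) = (\<integral>x. X n x * X n x \<partial>M)"
    by (rule martingale_le[OF assms, where B=1]) (auto simp: X_bounded)
  have [simp]: "integrable M (\<lambda>x. X i x * X j x)" for i j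
    using X_bounded by (intro integrable_bounded[where B=1]) (auto simp: abs_mult mult_le_one)
  have "(\<integral>x. (X m x - X n x)\<^sup>2 \<partial>M) = (\<integral>x. X m x * X m x - 2 * (X n x * X m x) + X n x * X n x \<partial>M)"
    by (intro Bochner_Integration.integral_cong) (auto simp: power2_eq_square algebra_simps)
  also have "\<dots> = (\<integral>x. (X m x)\<^sup>2 \<partial>M) - (\<integral>x. (X n x)\<^sup>2 \<partial>M)"
    by (simp add: eq power2_eq_square)
  finally show ?thesis .
qed

text \<open>Kolmogorov's maximal inequality. The event grows with \<open>m\<close>: on its old part
  the squared deviation does not decrease in mean, and on its new part the deviation is already at
  least \<open>\<epsilon>\<close>.\<close>

lemma maximal_inequality:
  assumes "n \<le> m" "0 < \<epsilon>"
  shows "\<epsilon>\<^sup>2 * prob {x \<in> space M. \<exists>k\<in>{n..m}. \<epsilon> \<le> \<bar>X k x - X n x\<bar>} \<le> (\<integral>x. (X m x - X n x)\<^sup>2 \<partial>M)"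
proof -
  define S where "S m = {x \<in> space M. \<exists>k\<in>{n..m}. \<epsilon> \<le> \<bar>X k x - X n x\<bar>}" for m
  have [measurable]: "S m \<in> sets M" for m
    unfolding S_def by measurable
  have ind: "\<bar>indicator B x :: real\<bar> \<le> 1" for B x
    by (simp add: indicator_def)
  have int: "integrable M (\<lambda>x. indicator B x * (X i x - X j x)\<^sup>2)" if [measurable]: "B \<in> sets M" for B i j
    using X_diff_power2_le by (intro integrable_bounded[where B=4]) (auto simp: indicator_def)
  \<comment> \<open>The indicator on the right strengthens the claim so that the induction over
    \<open>m\<close> closes; it is dropped at the end.\<close>
  have "\<epsilon>\<^sup>2 * prob (S m) \<le> (\<integral>x. indicator (S m) x * (X m x - X n x)\<^sup>2 \<partial>M)"
    using \<open>n \<le> m\<close>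
  proof (induction rule: dec_induct)
    case base
    have "S n = {}" using assms by (auto simp: S_def)
    then show ?case by simp
  next
    case (step m)
    \<comment> \<open>\<open>Y\<close> is the test function that makes the cross term vanish in mean
      when the deviation is split at time \<open>m\<close>; \<open>T\<close> is the event that the
      threshold is first reached at \<open>Suc m\<close>.\<close>
    define Y where "Y x = indicator (S m) x * (X m x - X n x)" for x
    define T where "T = S (Suc m) - S m"
    have [measurable]: "T \<in> sets M" unfolding T_def by measurable
    have ST: "indicator (S (Suc m)) x = (indicator (S m) x + indicator T x :: real)" for x
      by (auto simp: T_def S_def indicator_def)
    have T: "\<epsilon> \<le> \<bar>X (Suc m) x - X n x\<bar>" if "x \<in> T" for x
      using that by (auto simp: T_def S_def le_Suc_eq)
    have Yb: "\<bar>Y x\<bar> \<le> 2" for x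
      using X_diff_le by (auto simp: Y_def indicator_def)
    have [measurable]: "Y \<in> borel_measurable M" unfolding Y_def by measurable
    have Y_history: "Y x = Y y"
      if xy: "x \<in> space M" "y \<in> space M" "\<And>i. i \<le> m \<Longrightarrow> X i x = X i y" for x y
    proof -
      have "X k x - X n x = X k y - X n y" if "k \<le> m" for k
        using xy(3)[of n] xy(3)[OF that] step.hyps by simp
      then have "x \<in> S m \<longleftrightarrow> y \<in> S m" "X m x - X n x = X m y - X n y"
        using xy(1,2) by (auto simp: S_def)
      then show ?thesis
        by (simp add: Y_def indicator_def)
    qed
    have eq: "(\<integral>x. Y x * X (Suc m) x \<partial>M) = (\<integral>x. Y x * X m x \<partial>M)"
      by (rule martingale[OF _ Yb Y_history]) auto
    have intY: "integrable M (\<lambda>x. Y x * X i x)" for i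
    proof (rule integrable_bounded[where B=2])
      show "\<bar>Y x * X i x\<bar> \<le> 2" for x
        using mult_mono[OF Yb[of x] X_bounded[of i x]] by (simp add: abs_mult)
    qed measurable
    have "\<epsilon>\<^sup>2 * prob (S (Suc m)) = \<epsilon>\<^sup>2 * (\<integral>x. indicator (S m) x + indicator T x \<partial>M)"
      by (subst ST[symmetric]) simp
    also have "\<dots> = \<epsilon>\<^sup>2 * prob (S m) + (\<integral>x. \<epsilon>\<^sup>2 * indicator T x \<partial>M)"
      by (subst Bochner_Integration.integral_add)
        (auto simp: distrib_left intro!: integrable_bounded[OF _ ind])
    also have "\<dots> \<le> (\<integral>x. indicator (S m) x * (X m x - X n x)\<^sup>2 \<partial>M) +
        (\<integral>x. indicator T x * (X (Suc m) x - X n x)\<^sup>2 \<partial>M)"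
    proof (intro add_mono step.IH integral_mono int)
      show "integrable M (\<lambda>x. \<epsilon>\<^sup>2 * indicator T x)"
        by (intro integrable_mult_right integrable_bounded[OF _ ind]) measurable
      show "\<epsilon>\<^sup>2 * indicator T x \<le> indicator T x * (X (Suc m) x - X n x)\<^sup>2" for x
        using T[of x] assms(2) abs_le_square_iff[of \<epsilon> "X (Suc m) x - X n x"]
        by (auto simp: indicator_def)
    qed auto
    \<comment> \<open>A cross term of integral zero is added. On \<open>S m\<close> the integrand
      then is the squared deviation at \<open>Suc m\<close> minus the square of the last
      increment.\<close>
    also have "(\<integral>x. indicator (S m) x * (X m x - X n x)\<^sup>2 \<partial>M) =
        (\<integral>x. indicator (S m) x * (X m x - X n x)\<^sup>2 + 2 * (Y x * X (Suc m) x) - 2 * (Y x * X m x) \<partial>M)"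
      using int[of "S m"] intY by (simp add: eq)
    also have "\<dots> \<le> (\<integral>x. indicator (S m) x * (X (Suc m) x - X n x)\<^sup>2 \<partial>M)"
    proof (intro integral_mono Bochner_Integration.integrable_add Bochner_Integration.integrable_diff
        int integrable_mult_right intY)
      fix x
      have "0 \<le> (X (Suc m) x - X m x)\<^sup>2" by simp
      then show "indicator (S m) x * (X m x - X n x)\<^sup>2 + 2 * (Y x * X (Suc m) x) - 2 * (Y x * X m x)
          \<le> indicator (S m) x * (X (Suc m) x - X n x)\<^sup>2"
        by (simp add: Y_def indicator_def power2_eq_square algebra_simps)
    qed auto
    also have "(\<integral>x. indicator (S m) x * (X (Suc m) x - X n x)\<^sup>2 \<partial>M) +
        (\<integral>x. indicator T x * (X (Suc m) x - X n x)\<^sup>2 \<partial>M) =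
        (\<integral>x. indicator (S (Suc m)) x * (X (Suc m) x - X n x)\<^sup>2 \<partial>M)"
      by (simp add: ST int distrib_right)
    finally show ?case by simp
  qed
  also have "\<dots> \<le> (\<integral>x. (X m x - X n x)\<^sup>2 \<partial>M)"
    using X_diff_power2_le
    by (intro integral_mono int integrable_bounded[where B=4]) (auto simp: indicator_def)
  finally show ?thesis by (simp add: S_def)
qed

text \<open>The second moments increase to a limit \<open>L\<close>. By the maximal inequality, the
  path after time \<open>n\<close> ever departs from \<open>X n\<close> by \<open>\<epsilon>\<close>
  with probability at most \<open>(L - a n) / \<epsilon>\<^sup>2\<close>, which tends to 0. Almost
  every path is therefore Cauchy.\<close>

lemma AE_convergent: "AE x in M. convergent (\<lambda>n. X n x)"
proof -
  define a where "a n = (\<integral>x. (X n x)\<^sup>2 \<partial>M)" for n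
  have mono: "incseq a"
  proof (rule monoI)
    show "a n \<le> a m" if "n \<le> m" for n m
      using expectation_increment[OF that] Bochner_Integration.integral_nonneg[of M "\<lambda>x. (X m x - X n x)\<^sup>2"]
      by (simp add: a_def)
  qed
  have "a n \<le> (\<integral>x. 1 \<partial>M)" for n
    unfolding a_def using X_bounded
    by (intro integral_mono integrable_X_power) (auto simp: abs_square_le_1)
  then have "a n \<le> 1" for n by (simp add: prob_space)
  then obtain L where L: "a \<longlonglongrightarrow> L" "\<And>n. a n \<le> L"
    using incseq_convergent[OF mono] by metis
  define B where "B \<epsilon> n m = {x \<in> space M. \<exists>k\<in>{n..m}. \<epsilon> \<le> \<bar>X k x - X n x\<bar>}" for \<epsilon> n m
  have [measurable]: "B \<epsilon> n m \<in> sets M" for \<epsilon> n m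
    unfolding B_def by measurable
  have prob_B: "prob (B \<epsilon> n m) \<le> (L - a n) / \<epsilon>\<^sup>2" if "0 < \<epsilon>" for \<epsilon> n m
  proof (cases "n \<le> m")
    case True
    have "\<epsilon>\<^sup>2 * prob (B \<epsilon> n m) \<le> a m - a n"
      using maximal_inequality[OF True that] by (simp add: B_def a_def expectation_increment[OF True])
    then have "\<epsilon>\<^sup>2 * prob (B \<epsilon> n m) \<le> L - a n"
      using L(2)[of m] by simp
    then show ?thesis using that by (simp add: field_simps)
  next
    case False
    then have "B \<epsilon> n m = {}" by (auto simp: B_def)
    then show ?thesis using L(2)[of n] that by simp
  qed
  have prob_UN: "prob (\<Union>m. B \<epsilon> n m) \<le> (L - a n) / \<epsilon>\<^sup>2" if "0 < \<epsilon>" for \<epsilon> n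
  proof (rule LIMSEQ_le_const2[OF finite_Lim_measure_incseq])
    show "incseq (B \<epsilon> n)" by (rule monoI) (auto simp: B_def)
    show "\<exists>N. \<forall>m\<ge>N. prob (B \<epsilon> n m) \<le> (L - a n) / \<epsilon>\<^sup>2" using prob_B[OF that] by blast
  qed auto
  have "AE x in M. \<exists>n. x \<notin> (\<Union>m. B \<epsilon> n m)" if "0 < \<epsilon>" for \<epsilon>
  proof -
    let ?N = "\<Inter>n. \<Union>m. B \<epsilon> n m"
    have "(\<lambda>n. (L - a n) / \<epsilon>\<^sup>2) \<longlonglongrightarrow> (L - L) / \<epsilon>\<^sup>2"
      by (intro tendsto_intros L) (use that in auto)
    moreover have "prob ?N \<le> (L - a n) / \<epsilon>\<^sup>2" for n
      by (rule order_trans[OF finite_measure_mono prob_UN[OF that]]) auto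
    ultimately have "prob ?N \<le> (L - L) / \<epsilon>\<^sup>2"
      by (intro LIMSEQ_le_const) auto
    then have "prob ?N = 0"
      by (intro antisym measure_nonneg) simp
    then have "?N \<in> null_sets M"
      by (auto simp: null_sets_def emeasure_eq_measure)
    then show ?thesis
      by (rule AE_I'[rotated 1, OF _ , rotated]) auto
  qed
  then have "AE x in M. \<forall>r. \<exists>n. x \<notin> (\<Union>m. B (inverse (real (Suc r))) n m)"
    by (auto simp: AE_all_countable)
  with AE_space show ?thesis
  proof eventually_elim
    case (elim x)
    have "Cauchy (\<lambda>n. X n x)"
    proof (rule CauchyI')
      fix e :: real assume "0 < e"
      then obtain r where r: "inverse (real (Suc r)) < e / 2"
        using reals_Archimedean[of "e / 2"] by auto
      obtain n where n: "\<And>m. x \<notin> B (inverse (real (Suc r))) n m"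
        using elim by blast
      have close: "\<bar>X m x - X n x\<bar> < e / 2" if "n \<le> m" for m
        using n[of m] elim(1) that r by (force simp: B_def)
      show "\<exists>N. \<forall>m\<ge>N. \<forall>k>m. dist (X m x) (X k x) < e"
      proof (intro exI allI impI)
        fix m k assume "n \<le> m" "m < k"
        then show "dist (X m x) (X k x) < e"
          using close[of m] close[of k] unfolding dist_real_def by linarith
      qed
    qed
    then show ?case by (rule Cauchy_convergent)
  qed
qed

end

section \<open>The quenched process\<close>

text \<open>Splicing two independent samples along \<open>J\<close> is how independence of the
  coordinates in \<open>J\<close> from the others is put to use.\<close>

definition mix :: "'i set \<Rightarrow> ('i \<Rightarrow> 'a) \<times> ('i \<Rightarrow> 'a) \<Rightarrow> 'i \<Rightarrow> 'a" where
  "mix J = (\<lambda>(x, y) i. if i \<in> J then x i else y i)"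

text \<open>The preimage of a cylinder is a rectangle, and the product over its coordinates splits
  along \<open>J\<close>. With \<open>I = UNIV\<close> every function is extensional, so no default
  values outside \<open>I\<close> arise.\<close>

lemma (in product_prob_space) distr_mix:
  assumes "I = UNIV"
  shows "mix J \<in> measurable (PiM I M \<Otimes>\<^sub>M PiM I M) (PiM I M)" (is ?meas)
    and "distr (PiM I M \<Otimes>\<^sub>M PiM I M) (PiM I M) (mix J) = PiM I M"
proof -
  let ?P = "PiM I M"
  show meas: ?meas
  proof (rule measurable_PiM_single')
    show "(\<lambda>xy. mix J xy i) \<in> measurable (?P \<Otimes>\<^sub>M ?P) (M i)" if "i \<in> I" for i
      using that by (cases "i \<in> J") (simp_all add: mix_def split_beta' assms)
  qed (auto simp: mix_def assms space_pair_measure space_PiM PiE_iff)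
  show "distr (?P \<Otimes>\<^sub>M ?P) ?P (mix J) = ?P"
  proof (rule PiM_eq)
    fix K E assume K: "finite K" "K \<subseteq> I" "\<And>j. j \<in> K \<Longrightarrow> E j \<in> sets (M j)"
    let ?emb = "\<lambda>K. prod_emb I M K (\<Pi>\<^sub>E j\<in>K. E j)"
    have E: "?emb L \<in> sets ?P" if "L \<subseteq> K" for L
      using K that by (intro sets_PiM_I) (auto intro: finite_subset)
    have "mix J -` ?emb K \<inter> space (?P \<Otimes>\<^sub>M ?P) = ?emb (K \<inter> J) \<times> ?emb (K - J)"
    proof (rule set_eqI)
      fix xy :: "('i \<Rightarrow> 'a) \<times> ('i \<Rightarrow> 'a)"
      obtain x y where xy: "xy = (x, y)" by (cases xy)
      have "(\<forall>j\<in>K. mix J xy j \<in> E j) \<longleftrightarrow> (\<forall>j\<in>K \<inter> J. x j \<in> E j) \<and> (\<forall>j\<in>K - J. y j \<in> E j)"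
        by (auto simp: mix_def xy)
      moreover have "mix J xy \<in> space ?P" if "xy \<in> space (?P \<Otimes>\<^sub>M ?P)"
        using measurable_space[OF meas that] .
      ultimately show "xy \<in> mix J -` ?emb K \<inter> space (?P \<Otimes>\<^sub>M ?P) \<longleftrightarrow> xy \<in> ?emb (K \<inter> J) \<times> ?emb (K - J)"
        by (auto simp: prod_emb_iff space_pair_measure space_PiM xy PiE_iff assms)
    qed
    then have "emeasure (distr (?P \<Otimes>\<^sub>M ?P) ?P (mix J)) (?emb K) =
        emeasure (?P \<Otimes>\<^sub>M ?P) (?emb (K \<inter> J) \<times> ?emb (K - J))"
      using E[of K] by (simp add: emeasure_distr[OF meas])
    also have "\<dots> = emeasure ?P (?emb (K \<inter> J)) * emeasure ?P (?emb (K - J))"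
      using E by (intro P.emeasure_pair_measure_Times) auto
    also have "\<dots> = (\<Prod>j\<in>K \<inter> J. emeasure (M j) (E j)) * (\<Prod>j\<in>K - J. emeasure (M j) (E j))"
      using K by (subst (1 2) emeasure_PiM_emb) auto
    also have "\<dots> = (\<Prod>j\<in>K. emeasure (M j) (E j))"
      using K(1) by (metis prod.Int_Diff)
    finally show "emeasure (distr (?P \<Otimes>\<^sub>M ?P) ?P (mix J)) (?emb K) = (\<Prod>j\<in>K. emeasure (M j) (E j))" .
  qed simp
qed

section \<open>Offspring numbers and population size under the quenched measure\<close>

context
  fixes e :: "int \<Rightarrow> nat pmf"
begin

abbreviation "Q \<equiv> quenched e"

interpretation Q: product_prob_space "\<lambda>k :: nat \<times> nat. measure_pmf (e (int (fst k)))" UNIV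
  by (intro product_prob_spaceI measure_pmf.prob_space_axioms)

lemma prob_space_quenched: "prob_space Q"
  unfolding quenched_def by (rule Q.prob_space_axioms)

lemma space_quenched: "space Q = UNIV"
  by (simp add: quenched_def space_PiM)

lemma measurable_offspring_pmf: "(\<lambda>x. x k) \<in> measurable Q (measure_pmf (e (int (fst k))))"
  unfolding quenched_def by (rule measurable_component_singleton) simp

lemma measurable_offspring[measurable]: "(\<lambda>x. x k) \<in> measurable Q (count_space UNIV)"
  using measurable_offspring_pmf[of k] by (simp cong: measurable_cong_sets)

lemma measurable_Z[measurable]: "Z n \<in> measurable Q (count_space UNIV)"
proof (induction n)
  case (Suc n)
  note Suc[measurable]
  \<comment> \<open>The number of summands is random; a fixed number \<open>k\<close> suffices
    because \<open>Z n\<close> takes countably many values.\<close>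
  have "(\<lambda>x. \<Sum>i<k. x (n, i)) \<in> measurable Q (count_space UNIV)" for k
    by measurable
  then have "(\<lambda>x. \<Sum>i<Z n x. x (n, i)) \<in> measurable Q (count_space UNIV)"
    by (rule measurable_compose_countable) (rule Suc)
  then show ?case by simp
qed simp

lemma Z_cong:
  assumes "\<And>k i. k < n \<Longrightarrow> x (k, i) = y (k, i)"
  shows "Z n x = Z n y"
  using assms by (induction n) auto

lemma expectation_offspring_prod:
  assumes "0 \<le> v" "v \<le> 1"
  shows "(\<integral>x. v ^ (\<Sum>i<k. x (n, i)) \<partial>Q) = pgf (e (int n)) v ^ k"
proof -
  interpret prob_space Q by (rule prob_space_quenched)
  have "distr Q (\<Pi>\<^sub>M k\<in>UNIV. measure_pmf (e (int (fst k)))) (\<lambda>x. \<lambda>k\<in>UNIV. x k) =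
      (\<Pi>\<^sub>M k\<in>UNIV. distr Q (measure_pmf (e (int (fst k)))) (\<lambda>x. x k))"
    unfolding quenched_def by (simp add: Q.PiM_component restrict_UNIV distr_id2 cong: PiM_cong)
  then have indep: "indep_vars (\<lambda>k. measure_pmf (e (int (fst k)))) (\<lambda>k x. x k) UNIV"
    by (subst indep_vars_iff_distr_eq_PiM'[OF UNIV_not_empty measurable_offspring_pmf])
  have marginal: "(\<integral>x. v ^ x (n, i) \<partial>Q) = pgf (e (int n)) v" for i
  proof -
    have "measure_pmf (e (int n)) = distr Q (measure_pmf (e (int n))) (\<lambda>x. x (n, i))"
      unfolding quenched_def using Q.PiM_component[of "(n, i)"] by simp
    then have "pgf (e (int n)) v = (\<integral>j. v ^ j \<partial>distr Q (measure_pmf (e (int n))) (\<lambda>x. x (n, i)))"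
      using assms by (simp add: pgf_eq_expectation)
    also have "\<dots> = (\<integral>x. v ^ x (n, i) \<partial>Q)"
      by (rule integral_distr) (simp_all cong: measurable_cong_sets)
    finally show ?thesis by simp
  qed
  have "(\<integral>x. v ^ (\<Sum>i<k. x (n, i)) \<partial>Q) = (\<integral>x. (\<Prod>j\<in>Pair n ` {..<k}. v ^ x j) \<partial>Q)"
    by (simp add: power_sum prod.reindex inj_on_def)
  also have "\<dots> = (\<Prod>j\<in>Pair n ` {..<k}. \<integral>x. v ^ x j \<partial>Q)"
  proof (rule indep_vars_lebesgue_integral)
    show "indep_vars (\<lambda>_. borel) (\<lambda>j x. v ^ x j) (Pair n ` {..<k})"
      by (rule indep_vars_compose2[OF indep_vars_subset[OF indep]]) auto
    show "integrable Q (\<lambda>x. v ^ x j)" for j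
      using assms by (intro integrable_const_bound[of _ 1]) (auto simp: power_le_one)
  qed simp
  also have "\<dots> = (\<Prod>i<k. \<integral>x. v ^ x (n, i) \<partial>Q)"
    by (simp add: prod.reindex inj_on_def)
  also have "\<dots> = pgf (e (int n)) v ^ k"
    by (simp add: marginal)
  finally show ?thesis .
qed

text \<open>This is the conditional expectation of \<open>v ^ Z (Suc n) x\<close> given the rows
  below \<open>n\<close>, in test function form. Resampling all rows from \<open>n\<close> on
  preserves the quenched measure, and Fubini then averages the fresh offspring for a fixed
  past.\<close>

lemma expectation_step:
  fixes Y :: "(nat \<times> nat \<Rightarrow> nat) \<Rightarrow> real"
  assumes v: "0 \<le> v" "v \<le> 1"
    and Y[measurable]: "Y \<in> borel_measurable Q" and B: "\<And>x. \<bar>Y x\<bar> \<le> B"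
    and past: "\<And>x y. (\<And>k i. k < n \<Longrightarrow> x (k, i) = y (k, i)) \<Longrightarrow> Y x = Y y"
  shows "(\<integral>x. Y x * v ^ Z (Suc n) x \<partial>Q) = (\<integral>x. Y x * pgf (e (int n)) v ^ Z n x \<partial>Q)"
proof -
  interpret prob_space Q by (rule prob_space_quenched)
  interpret QQ: pair_prob_space Q Q ..
  let ?J = "{k :: nat \<times> nat. fst k < n}"
  let ?m = "mix ?J :: _ \<times> _ \<Rightarrow> nat \<times> nat \<Rightarrow> nat"
  let ?g = "\<lambda>x. Y x * v ^ Z (Suc n) x"
  have meas[measurable]: "?m \<in> measurable (Q \<Otimes>\<^sub>M Q) Q" and Q: "distr (Q \<Otimes>\<^sub>M Q) Q ?m = Q"
    unfolding quenched_def by (rule Q.distr_mix; simp)+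
  have g: "\<bar>?g x\<bar> \<le> B" for x
    using mult_mono[OF B[of x], of "\<bar>v ^ Z (Suc n) x\<bar>" 1] v B[of x]
    by (simp add: abs_mult power_le_one del: Z.simps)
  have [measurable]: "?g \<in> borel_measurable Q" by measurable
  \<comment> \<open>\<open>Y\<close> and \<open>Z n\<close> read only rows below \<open>n\<close>,
    taken from \<open>x\<close>; the offspring being summed form row \<open>n\<close>, taken from
    \<open>y\<close>.\<close>
  have mix_g: "?g (?m (x, y)) = Y x * v ^ (\<Sum>i<Z n x. y (n, i))" for x y
  proof -
    have "Y (?m (x, y)) = Y x" "Z n (?m (x, y)) = Z n x"
      by (intro past Z_cong; simp add: mix_def)+
    then show ?thesis by (simp add: mix_def)
  qed
  have g_mix: "(\<lambda>xy. ?g (?m xy)) \<in> borel_measurable (Q \<Otimes>\<^sub>M Q)"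
    by (rule measurable_compose[OF meas]) measurable
  have int: "integrable (Q \<Otimes>\<^sub>M Q) (\<lambda>xy. ?g (?m xy))"
    by (rule QQ.P.integrable_const_bound[OF _ g_mix, where B=B]) (simp only: real_norm_def g eventually_True)
  have "(\<integral>x. ?g x \<partial>Q) = (\<integral>x. ?g x \<partial>distr (Q \<Otimes>\<^sub>M Q) Q ?m)"
    by (simp only: Q)
  also have "\<dots> = (\<integral>xy. ?g (?m xy) \<partial>(Q \<Otimes>\<^sub>M Q))"
    by (rule integral_distr[OF meas]) measurable
  also have "\<dots> = (\<integral>x. \<integral>y. ?g (?m (x, y)) \<partial>Q \<partial>Q)"
    by (rule QQ.integral_fst'[OF int, symmetric])
  also have "\<dots> = (\<integral>x. Y x * pgf (e (int n)) v ^ Z n x \<partial>Q)"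
    unfolding mix_g using v by (simp add: expectation_offspring_prod)
  finally show ?thesis .
qed

lemma expectation_power_Z:
  assumes "0 \<le> v" "v \<le> 1"
  shows "(\<integral>x. v ^ Z n x \<partial>Q) = pgf_iter n e v"
  using assms
proof (induction n arbitrary: v)
  case 0
  interpret prob_space Q by (rule prob_space_quenched)
  show ?case by (simp add: prob_space)
next
  case (Suc n)
  have "(\<integral>x. v ^ Z (Suc n) x \<partial>Q) = (\<integral>x. pgf (e (int n)) v ^ Z n x \<partial>Q)"
    using expectation_step[OF Suc.prems, of "\<lambda>_. 1" 1 n] by (simp del: Z.simps)
  then show ?case
    using Suc.IH[OF pgf_bounds[OF Suc.prems]] by (simp del: Z.simps)
qed

end

section \<open>Regularity in terms of generating functions\<close>

text \<open>The equation on the right means that \<open>y\<close> is 0 or 1. A limit 0 forces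
  \<open>X\<close> to infinity; a positive limit makes \<open>X\<close> converge to the finite
  number \<open>- ln y\<close>, which is 0 only for \<open>y = 1\<close>.\<close>

lemma lim_ereal_eq_0_or_PInfty_iff:
  fixes X :: "nat \<Rightarrow> real"
  assumes lim: "(\<lambda>n. exp (- X n)) \<longlonglongrightarrow> y"
  shows "lim (\<lambda>n. ereal (X n)) \<in> {0, \<infinity>} \<longleftrightarrow> y - y\<^sup>2 = 0"
proof (cases "y = 0")
  case True
  have "filterlim (\<lambda>n. exp (- X n)) (at_right 0) sequentially"
    using lim True by (simp add: filterlim_at)
  then have "filterlim (\<lambda>n. ln (exp (- X n))) at_bot sequentially"
    by (rule filterlim_compose[OF ln_at_0])
  then have "filterlim X at_top sequentially"
    by (simp add: filterlim_uminus_at_top)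
  then have "(\<lambda>n. ereal (X n)) \<longlonglongrightarrow> \<infinity>"
    by (simp add: tendsto_PInfty_eq_at_top)
  then show ?thesis using True by (simp add: limI)
next
  case False
  moreover have "0 \<le> y"
    by (rule LIMSEQ_le_const[OF lim]) auto
  ultimately have "0 < y" by simp
  then have "(\<lambda>n. - ln (exp (- X n))) \<longlonglongrightarrow> - ln y"
    by (intro tendsto_intros lim) auto
  then have "(\<lambda>n. ereal (X n)) \<longlonglongrightarrow> ereal (- ln y)" by simp
  then have "lim (\<lambda>n. ereal (X n)) = ereal (- ln y)" by (rule limI)
  with \<open>0 < y\<close> show ?thesis
    by (auto simp: power2_eq_square)
qed

text \<open>Bounded convergence carries both moments to the limit \<open>Y\<close>, and the integral
  of the nonnegative \<open>Y x - (Y x)\<^sup>2\<close> is zero iff the integrand vanishes almost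
  surely. The inequality for \<open>L\<close> is recorded so that later only
  \<open>L < exp (- s)\<close> has to be refuted.\<close>

lemma regular_point_iff:
  assumes alive: "\<And>n. pmf (e (int n)) 0 = 0" and "0 < s"
  obtains L where "(\<lambda>n. pgf_iter n e ((exp (- h_iter n e s))\<^sup>2)) \<longlonglongrightarrow> L" "L \<le> exp (- s)"
    "regular_point e s \<longleftrightarrow> L = exp (- s)"
proof -
  define u where "u n = exp (- h_iter n e s)" for n
  define X where "X n x = u n ^ Z n x" for n x
  have u: "0 \<le> u n" "u n \<le> 1" for n
    using exp_neg_h_iter(1)[of e s n] assms by (auto simp: u_def)
  have X: "0 \<le> X n x" "X n x \<le> 1" for n x
    using u[of n] by (auto simp: X_def power_le_one)
  have X_exp: "X n x = exp (- (real (Z n x) * h_iter n e s))" for n x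
    by (simp add: X_def u_def exp_of_nat_mult[symmetric])
  interpret bounded_martingale "quenched e" X
  proof (intro bounded_martingale.intro prob_space_quenched bounded_martingale_axioms.intro)
    show "X n \<in> borel_measurable (quenched e)" for n
      unfolding X_def by measurable
    show "\<bar>X n x\<bar> \<le> 1" for n x
      using X[of n x] by simp
  next
    fix Y :: "(nat \<times> nat \<Rightarrow> nat) \<Rightarrow> real" and B n
    assume Y: "Y \<in> borel_measurable (quenched e)" "\<And>x. \<bar>Y x\<bar> \<le> B"
      and past: "\<And>x y. x \<in> space (quenched e) \<Longrightarrow> y \<in> space (quenched e) \<Longrightarrow>
        (\<And>i. i \<le> n \<Longrightarrow> X i x = X i y) \<Longrightarrow> Y x = Y y"
    \<comment> \<open>For \<open>i \<le> n\<close>, \<open>X i\<close> sees the sample only through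
      rows below \<open>n\<close>, so a test function of the history meets the requirement of
      \<open>expectation_step\<close>.\<close>
    have "Y x = Y y" if "\<And>k i. k < n \<Longrightarrow> x (k, i) = y (k, i)" for x y
    proof (rule past)
      show "X i x = X i y" if "i \<le> n" for i
        using Z_cong[of i x y] that \<open>\<And>k i. k < n \<Longrightarrow> x (k, i) = y (k, i)\<close> by (simp add: X_def)
    qed (simp_all add: space_quenched)
    from expectation_step[OF u(1)[of "Suc n"] u(2)[of "Suc n"] Y this]
    show "(\<integral>x. Y x * X (Suc n) x \<partial>quenched e) = (\<integral>x. Y x * X n x \<partial>quenched e)"
      using exp_neg_h_iter(3)[of e s n] assms by (simp add: X_def u_def del: Z.simps h_iter.simps)
  qed
  \<comment> \<open>\<open>lim\<close> is total, which makes \<open>Y\<close> measurable on the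
    whole space; it is known to be an actual limit only almost surely.\<close>
  define Y where "Y x = lim (\<lambda>n. X n x)" for x
  have [measurable]: "Y \<in> borel_measurable (quenched e)"
    unfolding Y_def by measurable
  have lim: "AE x in quenched e. (\<lambda>n. X n x) \<longlonglongrightarrow> Y x"
    using AE_convergent by (auto simp: Y_def convergent_LIMSEQ_iff elim: eventually_mono)
  have lim2: "AE x in quenched e. (\<lambda>n. (X n x)\<^sup>2) \<longlonglongrightarrow> (Y x)\<^sup>2"
    using lim by eventually_elim (rule tendsto_power)
  have dominated: "integrable (quenched e) f \<and> (\<lambda>n. \<integral>x. g n x \<partial>quenched e) \<longlonglongrightarrow> (\<integral>x. f x \<partial>quenched e)"
    if [measurable]: "f \<in> borel_measurable (quenched e)" "\<And>n. g n \<in> borel_measurable (quenched e)"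
      and "AE x in quenched e. (\<lambda>n. g n x) \<longlonglongrightarrow> f x" "\<And>n x. \<bar>g n x\<bar> \<le> 1" for f and g :: "nat \<Rightarrow> _ \<Rightarrow> real"
    using that(3,4)
    by (auto intro!: integral_dominated_convergence[where w="\<lambda>_. 1"]
        integrable_dominated_convergence[where w="\<lambda>_. 1" and s=g])
  have Y: "integrable (quenched e) Y" "(\<lambda>n. \<integral>x. X n x \<partial>quenched e) \<longlonglongrightarrow> (\<integral>x. Y x \<partial>quenched e)"
    using dominated[of Y X] lim X_bounded by auto
  have Y2: "integrable (quenched e) (\<lambda>x. (Y x)\<^sup>2)"
    "(\<lambda>n. \<integral>x. (X n x)\<^sup>2 \<partial>quenched e) \<longlonglongrightarrow> (\<integral>x. (Y x)\<^sup>2 \<partial>quenched e)"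
    using dominated[of "\<lambda>x. (Y x)\<^sup>2" "\<lambda>n x. (X n x)\<^sup>2"] lim2 X by (auto simp: power_le_one)
  have EX: "(\<integral>x. X n x \<partial>quenched e) = exp (- s)" for n
    using exp_neg_h_iter(2)[of e s n] assms u by (simp add: X_def expectation_power_Z u_def)
  have EX2: "(\<integral>x. (X n x)\<^sup>2 \<partial>quenched e) = pgf_iter n e ((u n)\<^sup>2)" for n
    using expectation_power_Z[of "(u n)\<^sup>2" e n] u[of n]
    by (simp add: X_def power_le_one power_mult[symmetric] mult.commute)
  have EY: "(\<integral>x. Y x \<partial>quenched e) = exp (- s)"
    using LIMSEQ_unique[OF Y(2)] by (simp add: EX)
  have Y_le: "AE x in quenched e. 0 \<le> Y x - (Y x)\<^sup>2"
    using lim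
  proof eventually_elim
    case (elim x)
    have "0 \<le> Y x" "Y x \<le> 1"
      by (rule LIMSEQ_le_const[OF elim], use X in blast) (rule LIMSEQ_le_const2[OF elim], use X in blast)
    then show ?case by (simp add: power2_eq_square mult_left_le)
  qed
  have W_iff: "AE x in quenched e. W e s x \<in> {0, \<infinity>} \<longleftrightarrow> Y x - (Y x)\<^sup>2 = 0"
    using lim by eventually_elim (unfold W_def, rule lim_ereal_eq_0_or_PInfty_iff, simp add: X_exp)
  have [measurable]: "W e s \<in> borel_measurable (quenched e)"
    unfolding W_def by measurable
  show thesis
  proof (rule that)
    show "(\<lambda>n. pgf_iter n e ((exp (- h_iter n e s))\<^sup>2)) \<longlonglongrightarrow> (\<integral>x. (Y x)\<^sup>2 \<partial>quenched e)"
      using Y2(2) by (simp add: EX2 u_def)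
    show "(\<integral>x. (Y x)\<^sup>2 \<partial>quenched e) \<le> exp (- s)"
      using integral_nonneg_AE[OF Y_le] by (simp add: Y(1) Y2(1) EY)
    have "regular_point e s \<longleftrightarrow> (AE x in quenched e. W e s x \<in> {0, \<infinity>})"
      unfolding regular_point_def by (rule prob_Collect_eq_1) measurable
    also have "\<dots> \<longleftrightarrow> (AE x in quenched e. Y x - (Y x)\<^sup>2 = 0)"
      by (rule eventually_subst[OF W_iff])
    also have "\<dots> \<longleftrightarrow> (\<integral>x. Y x - (Y x)\<^sup>2 \<partial>quenched e) = 0"
      by (rule integral_nonneg_eq_0_iff_AE[symmetric, OF _ Y_le]) (simp add: Y(1) Y2(1))
    also have "\<dots> \<longleftrightarrow> (\<integral>x. (Y x)\<^sup>2 \<partial>quenched e) = exp (- s)"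
      by (auto simp: Y(1) Y2(1) EY)
    finally show "regular_point e s \<longleftrightarrow> (\<integral>x. (Y x)\<^sup>2 \<partial>quenched e) = exp (- s)" .
  qed
qed

text \<open>This says that the upper limit of \<open>F\<^sub>n((F\<^sub>n\<^sup>-\<^sup>1(t))\<^sup>2)\<close> is at least \<open>t\<close> for all \<open>t\<close>, without
  reference to the inverse functions.\<close>

definition pgf_regular :: "(int \<Rightarrow> nat pmf) \<Rightarrow> bool" where
  "pgf_regular e \<longleftrightarrow> (\<forall>a t. 0 < a \<longrightarrow> a < t \<longrightarrow> t < 1 \<longrightarrow>
    (\<exists>\<^sub>F n in sequentially. \<exists>q\<in>{0..1}. pgf_iter n e q \<le> t \<and> a < pgf_iter n e (q\<^sup>2)))"

lemma pgf_regularD: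
  assumes "pgf_regular e" "0 < a" "a < t" "t < 1"
  shows "\<exists>\<^sub>F n in sequentially. \<exists>q\<in>{0..1}. pgf_iter n e q \<le> t \<and> a < pgf_iter n e (q\<^sup>2)"
  using assms by (auto simp: pgf_regular_def)

text \<open>If the process is regular, \<open>q = exp (- h_iter n e s)\<close> with
  \<open>exp (- s) = t\<close> is a witness for all large \<open>n\<close>. Conversely, monotonicity
  makes this \<open>q\<close> the best choice, and since the limit \<open>L\<close> exists,
  witnesses for infinitely many \<open>n\<close> already exclude
  \<open>L < exp (- s)\<close>.\<close>

lemma regular_process_iff:
  assumes alive: "\<And>n. pmf (e (int n)) 0 = 0"
  shows "regular_process e \<longleftrightarrow> pgf_regular e"
proof
  assume reg: "regular_process e"
  show "pgf_regular e"
    unfolding pgf_regular_def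
  proof (intro allI impI eventually_frequently)
    fix a t :: real
    assume "0 < a" "a < t" "t < 1"
    define s where "s = - ln t"
    have s: "0 < s" "exp (- s) = t"
      using \<open>0 < a\<close> \<open>a < t\<close> \<open>t < 1\<close> by (auto simp: s_def)
    obtain L where "(\<lambda>n. pgf_iter n e ((exp (- h_iter n e s))\<^sup>2)) \<longlonglongrightarrow> L"
      "regular_point e s \<longleftrightarrow> L = exp (- s)"
      using regular_point_iff[where e=e and s=s, OF alive s(1)] by blast
    then have "(\<lambda>n. pgf_iter n e ((exp (- h_iter n e s))\<^sup>2)) \<longlonglongrightarrow> t"
      using reg s by (simp add: regular_process_def)
    then have "\<forall>\<^sub>F n in sequentially. a < pgf_iter n e ((exp (- h_iter n e s))\<^sup>2)"
      using \<open>a < t\<close> by (rule order_tendstoD)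
    then show "\<forall>\<^sub>F n in sequentially. \<exists>q\<in>{0..1}. pgf_iter n e q \<le> t \<and> a < pgf_iter n e (q\<^sup>2)"
    proof eventually_elim
      case (elim n)
      then show ?case
        using exp_neg_h_iter[of e s n] alive s by (intro bexI[of _ "exp (- h_iter n e s)"]) auto
    qed
  qed simp
next
  assume reg: "pgf_regular e"
  show "regular_process e"
    unfolding regular_process_def
  proof (intro allI impI)
    fix s :: real
    assume s: "0 < s"
    let ?u = "\<lambda>n. exp (- h_iter n e s)"
    have u: "?u n \<in> {0..1}" "pgf_iter n e (?u n) = exp (- s)" for n
      using exp_neg_h_iter[of e s n] alive s by auto
    obtain L where L: "(\<lambda>n. pgf_iter n e ((?u n)\<^sup>2)) \<longlonglongrightarrow> L" "L \<le> exp (- s)"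
      "regular_point e s \<longleftrightarrow> L = exp (- s)"
      using regular_point_iff[where e=e and s=s, OF alive s] by blast
    have "\<not> L < exp (- s)"
    proof
      assume "L < exp (- s)"
      \<comment> \<open>The maximum with 0 secures the positivity that \<open>pgf_regular\<close>
        demands of its lower threshold.\<close>
      then obtain a where "max L 0 < a" "a < exp (- s)"
        using dense[of "max L 0" "exp (- s)"] by auto
      then have a: "L < a" "0 < a" "a < exp (- s)" by auto
      have "\<exists>\<^sub>F n in sequentially. \<exists>q\<in>{0..1}. pgf_iter n e q \<le> exp (- s) \<and> a < pgf_iter n e (q\<^sup>2)"
        using pgf_regularD[OF reg a(2,3)] s by simp
      moreover have "\<forall>\<^sub>F n in sequentially. pgf_iter n e ((?u n)\<^sup>2) < a"
        using L(1) a(1) by (rule order_tendstoD)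
      ultimately have "\<exists>\<^sub>F n in sequentially. False"
      proof (rule frequently_rev_mp[OF _ eventually_mono])
        fix n
        assume less: "pgf_iter n e ((?u n)\<^sup>2) < a"
        show "(\<exists>q\<in>{0..1}. pgf_iter n e q \<le> exp (- s) \<and> a < pgf_iter n e (q\<^sup>2)) \<longrightarrow> False"
        proof safe
          fix q :: real
          assume q: "q \<in> {0..1}" "pgf_iter n e q \<le> exp (- s)" "a < pgf_iter n e (q\<^sup>2)"
          then have "q \<le> ?u n"
            using pgf_iter_less_iff[of e "?u n" q n] alive u by force
          then have "q\<^sup>2 \<le> (?u n)\<^sup>2"
            using q(1) by (intro power_mono) auto
          moreover have "(?u n)\<^sup>2 < q\<^sup>2"
            using less q pgf_iter_less_iff[of e "(?u n)\<^sup>2" "q\<^sup>2" n] alive u(1)[of n]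
            by (auto simp: power_le_one)
          ultimately show False by simp
        qed
      qed
      then show False by simp
    qed
    then show "regular_point e s" using L by simp
  qed
qed

section \<open>Invariance under the shift of the environment\<close>

lemma frequently_sequentially_Suc:
  "(\<exists>\<^sub>F n in sequentially. P (Suc n)) \<longleftrightarrow> (\<exists>\<^sub>F n in sequentially. P n)"
  using eventually_sequentially_Suc[of "\<lambda>n. \<not> P n"] by (simp add: frequently_def)

text \<open>The strictly increasing bijection \<open>pgf (e 0)\<close> carries thresholds
  \<open>a < t\<close> for the shifted environment to thresholds for \<open>e\<close> and back;
  moving the index by one does not affect what happens infinitely often.\<close>

lemma pgf_regular_env_shift:
  assumes alive: "pmf (e 0) 0 = 0"
  shows "pgf_regular (env_shift 1 e) \<longleftrightarrow> pgf_regular e"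
proof
  let ?f = "pgf (e 0)" and ?F = "\<lambda>n. pgf_iter n (env_shift 1 e)"
  assume reg: "pgf_regular (env_shift 1 e)"
  show "pgf_regular e"
    unfolding pgf_regular_def
  proof (intro allI impI)
    fix a t :: real
    assume at: "0 < a" "a < t" "t < 1"
    obtain a' where a': "0 < a'" "a' < 1" "?f a' = a"
      using pgf_preimage[OF alive, of a] at by auto
    obtain t' where t': "0 < t'" "t' < 1" "?f t' = t"
      using pgf_preimage[OF alive, of t] at by auto
    have "a' < t'"
      using at a' t' pgf_less_iff[OF alive, of a' t'] by auto
    have "\<exists>\<^sub>F n in sequentially. \<exists>q\<in>{0..1}. pgf_iter (Suc n) e q \<le> t \<and> a < pgf_iter (Suc n) e (q\<^sup>2)"
      using pgf_regularD[OF reg a'(1) \<open>a' < t'\<close> t'(2)]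
    proof (rule frequently_elim1)
      fix n
      assume "\<exists>q\<in>{0..1}. ?F n q \<le> t' \<and> a' < ?F n (q\<^sup>2)"
      then obtain q where q: "q \<in> {0..1}" "?F n q \<le> t'" "a' < ?F n (q\<^sup>2)" by blast
      have "?f (?F n q) \<le> ?f t'"
        using q t' pgf_iter_bounds[of q n] by (intro pgf_mono) auto
      moreover have "?f a' < ?f (?F n (q\<^sup>2))"
        using q a' pgf_iter_bounds[of "q\<^sup>2" n] by (intro pgf_strict_mono alive) (auto simp: power_le_one)
      ultimately show "\<exists>q\<in>{0..1}. pgf_iter (Suc n) e q \<le> t \<and> a < pgf_iter (Suc n) e (q\<^sup>2)"
        using q(1) a' t' by (auto simp only: pgf_iter_shift)
    qed
    then show "\<exists>\<^sub>F n in sequentially. \<exists>q\<in>{0..1}. pgf_iter n e q \<le> t \<and> a < pgf_iter n e (q\<^sup>2)"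
      by (subst frequently_sequentially_Suc[symmetric])
  qed
next
  let ?f = "pgf (e 0)" and ?F = "\<lambda>n. pgf_iter n (env_shift 1 e)"
  assume reg: "pgf_regular e"
  show "pgf_regular (env_shift 1 e)"
    unfolding pgf_regular_def
  proof (intro allI impI)
    fix a t :: real
    assume at: "0 < a" "a < t" "t < 1"
    have f: "0 < ?f a" "?f a < ?f t" "?f t < 1"
      using at alive pgf_strict_mono[OF alive, of 0 a] pgf_strict_mono[OF alive, of a t]
        pgf_strict_mono[OF alive, of t 1] by (auto simp: pgf_0 pgf_1)
    have "\<exists>\<^sub>F n in sequentially. \<exists>q\<in>{0..1}. pgf_iter (Suc n) e q \<le> ?f t \<and> ?f a < pgf_iter (Suc n) e (q\<^sup>2)"
      by (rule frequently_sequentially_Suc[THEN iffD2, OF pgf_regularD[OF reg f]])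
    then show "\<exists>\<^sub>F n in sequentially. \<exists>q\<in>{0..1}. ?F n q \<le> t \<and> a < ?F n (q\<^sup>2)"
    proof (rule frequently_elim1)
      fix n
      assume "\<exists>q\<in>{0..1}. pgf_iter (Suc n) e q \<le> ?f t \<and> ?f a < pgf_iter (Suc n) e (q\<^sup>2)"
      then obtain q where q: "q \<in> {0..1}" "?f (?F n q) \<le> ?f t" "?f a < ?f (?F n (q\<^sup>2))"
        by (auto simp only: pgf_iter_shift)
      then have "?F n q \<le> t"
        using pgf_less_iff[OF alive, of t "?F n q"] pgf_iter_bounds[of q n] at by force
      moreover have "a < ?F n (q\<^sup>2)"
        using q pgf_less_iff[OF alive, of a "?F n (q\<^sup>2)"] pgf_iter_bounds[of "q\<^sup>2" n] at
        by (auto simp: power_le_one)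
      ultimately show "\<exists>q\<in>{0..1}. ?F n q \<le> t \<and> a < ?F n (q\<^sup>2)"
        using q(1) by blast
    qed
  qed
qed

section \<open>Measurability and the zero-one law\<close>

text \<open>Weak monotonicity holds in every environment; the reduction to rationals uses it on the
  whole environment space.\<close>

lemma pgf_iter_mono:
  assumes "0 \<le> s" "s \<le> r" "r \<le> 1"
  shows "pgf_iter n e s \<le> pgf_iter n e r"
  using assms by (induction n arbitrary: s r) (auto simp: pgf_bounds pgf_mono)

text \<open>Moving \<open>q\<close> slightly down to a rational keeps the upper bound by
  monotonicity and the strict lower bound by continuity. At \<open>q = 0\<close> there is no room
  below, but 0 is rational.\<close>

lemma pgf_iter_square_rational:
  assumes "q \<in> {0..1}" "pgf_iter n e q \<le> t" "a < pgf_iter n e (q\<^sup>2)"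
  obtains q' where "q' \<in> \<rat> \<inter> {0..1}" "pgf_iter n e q' \<le> t" "a < pgf_iter n e (q'\<^sup>2)"
proof (cases "q = 0")
  case True
  then show thesis using assms by (intro that[of 0]) auto
next
  case False
  have "continuous_on {0..1} (\<lambda>q. pgf_iter n e (q\<^sup>2))"
    by (rule continuous_on_compose2[OF continuous_on_pgf_iter])
      (auto intro!: continuous_intros simp: power_le_one)
  then obtain d where d: "0 < d"
    "\<And>r. r \<in> {0..1} \<Longrightarrow> dist r q < d \<Longrightarrow> dist (pgf_iter n e (r\<^sup>2)) (pgf_iter n e (q\<^sup>2)) < pgf_iter n e (q\<^sup>2) - a"
    using assms unfolding continuous_on_iff by (metis diff_gt_0_iff_gt)
  obtain r where r: "r \<in> \<rat>" "max 0 (q - d) < r" "r < q"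
    using Rats_dense_in_real[of "max 0 (q - d)" q] False assms d(1) by auto
  show thesis
  proof (rule that)
    show "r \<in> \<rat> \<inter> {0..1}" using r assms(1) by auto
    show "pgf_iter n e r \<le> t"
      using pgf_iter_mono[of r q n e] r assms by auto
    show "a < pgf_iter n e (r\<^sup>2)"
      using d(2)[of r] r assms(1) by (auto simp: dist_real_def)
  qed
qed

text \<open>Shrinking to rationals with \<open>a < a' < t' < t\<close> only strengthens the
  condition, so rational thresholds suffice and all quantifiers become countable.\<close>

lemma pgf_regular_iff_Rats:
  "pgf_regular e \<longleftrightarrow> (\<forall>a\<in>\<rat>. \<forall>t\<in>\<rat>. 0 < a \<longrightarrow> a < t \<longrightarrow> t < 1 \<longrightarrow>
    (\<exists>\<^sub>F n in sequentially. \<exists>q\<in>\<rat> \<inter> {0..1}. pgf_iter n e q \<le> t \<and> a < pgf_iter n e (q\<^sup>2)))"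
  (is "_ \<longleftrightarrow> ?R")
proof
  assume reg: "pgf_regular e"
  show ?R
  proof (intro ballI impI)
    fix a t :: real assume at: "0 < a" "a < t" "t < 1"
    show "\<exists>\<^sub>F n in sequentially. \<exists>q\<in>\<rat> \<inter> {0..1}. pgf_iter n e q \<le> t \<and> a < pgf_iter n e (q\<^sup>2)"
      using pgf_regularD[OF reg at]
      by (rule frequently_elim1) (meson pgf_iter_square_rational)
  qed
next
  assume R: ?R
  show "pgf_regular e"
    unfolding pgf_regular_def
  proof (intro allI impI)
    fix a t :: real assume at: "0 < a" "a < t" "t < 1"
    obtain a' where a': "a' \<in> \<rat>" "a < a'" "a' < t"
      using Rats_dense_in_real[OF at(2)] by blast
    obtain t' where t': "t' \<in> \<rat>" "a' < t'" "t' < t"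
      using Rats_dense_in_real[OF a'(3)] by blast
    have "\<exists>\<^sub>F n in sequentially. \<exists>q\<in>\<rat> \<inter> {0..1}. pgf_iter n e q \<le> t' \<and> a' < pgf_iter n e (q\<^sup>2)"
      using R a' t' at by auto
    then show "\<exists>\<^sub>F n in sequentially. \<exists>q\<in>{0..1}. pgf_iter n e q \<le> t \<and> a < pgf_iter n e (q\<^sup>2)"
    proof (rule frequently_elim1)
      fix n
      assume "\<exists>q\<in>\<rat> \<inter> {0..1}. pgf_iter n e q \<le> t' \<and> a' < pgf_iter n e (q\<^sup>2)"
      then show "\<exists>q\<in>{0..1}. pgf_iter n e q \<le> t \<and> a < pgf_iter n e (q\<^sup>2)"
        using a'(2) t'(3) by (meson IntD2 order_trans less_imp_le order_less_trans)
    qed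
  qed
qed

section \<open>Measurability in the environment\<close>

lemma space_offspring_space: "space offspring_space = UNIV"
  by (simp add: offspring_space_def)

lemma measurable_pmf_offspring_space: "(\<lambda>p. pmf p j) \<in> borel_measurable offspring_space"
proof -
  have "pmf \<in> measurable offspring_space (\<Pi>\<^sub>M j\<in>UNIV. borel)"
    unfolding offspring_space_def by (rule measurable_vimage_algebra1) (auto simp: space_PiM)
  then show ?thesis by (rule measurable_compose) simp
qed

lemma measurable_pmf_environment[measurable]: "(\<lambda>e. pmf (e n) j) \<in> borel_measurable environment_space"
proof -
  have "(\<lambda>e. e n) \<in> measurable environment_space offspring_space"
    unfolding environment_space_def by (rule measurable_component_singleton) simp
  from measurable_compose[OF this measurable_pmf_offspring_space] show ?thesis .
qed

text \<open>The argument may vary with the environment, so that the induction hypothesis accepts the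
  value of the inner generating function.\<close>

lemma measurable_pgf_iter:
  assumes "u \<in> borel_measurable environment_space"
  shows "(\<lambda>e. pgf_iter n e (u e)) \<in> borel_measurable environment_space"
  using assms
proof (induction n arbitrary: u)
  case (Suc n)
  note Suc.prems[measurable]
  have "(\<lambda>e. pgf (e (int n)) (u e)) \<in> borel_measurable environment_space"
    unfolding pgf_def by measurable
  then show ?case by (simp add: Suc.IH)
qed simp

lemma measurable_pgf_regular[measurable]: "Measurable.pred environment_space pgf_regular"
proof -
  note measurable_pgf_iter[measurable]
  have Ball: "Measurable.pred environment_space (\<lambda>e. \<forall>i\<in>I. P i e)"
    and Bex: "Measurable.pred environment_space (\<lambda>e. \<exists>i\<in>I. P i e)"
    if "countable I" "\<And>i. Measurable.pred environment_space (P i)" for I :: "real set" and P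
    using that by (auto simp: pred_def intro!: sets.sets_Collect_countable_Ball sets.sets_Collect_countable_Bex)
  show ?thesis
    unfolding pgf_regular_iff_Rats[abs_def] frequently_sequentially
    by (intro Ball Bex pred_intros_countable pred_intros_logic countable_rat countable_Int1) measurable
qed

section \<open>The shift and the zero-one law\<close>

lemma measurable_env_shift: "env_shift k \<in> measurable (\<Pi>\<^sub>M n\<in>UNIV. N) (\<Pi>\<^sub>M n\<in>UNIV. N)"
  by (rule measurable_PiM_single') (auto simp: env_shift_def space_PiM PiE_iff)

text \<open>As \<open>E\<close> is mapped into itself by the shift, it makes no difference to \<open>C\<close> if only the shifts by
  at least \<open>n\<close> are admitted. Hence \<open>C\<close> is a tail event.\<close>

lemma (in prob_space) shift_0_1_law:
  fixes \<xi> :: "int \<Rightarrow> 'a \<Rightarrow> 'b"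
  assumes indep: "indep_vars (\<lambda>_. N) \<xi> UNIV"
    and E: "E \<in> sets (\<Pi>\<^sub>M n\<in>UNIV. N)"
    and future: "\<And>e e'. (\<And>n. 0 \<le> n \<Longrightarrow> e n = e' n) \<Longrightarrow> e \<in> E \<Longrightarrow> e' \<in> E"
    and shift: "\<And>e. e \<in> E \<Longrightarrow> env_shift 1 e \<in> E"
  defines "C \<equiv> {\<omega> \<in> space M. \<exists>k. env_shift k (\<lambda>n. \<xi> n \<omega>) \<in> E}"
  shows "prob C = 0 \<or> prob C = 1"
proof (rule kolmogorov_0_1_law)
  \<comment> \<open>Kolmogorov's law is applied to a sequence indexed by the naturals: by
    \<open>future\<close>, \<open>E\<close> reads no negative coordinate, so the sigma-algebras of
    the coordinates 0, 1, ... are enough.\<close>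
  define F where "F i = {\<xi> (int i) -` S \<inter> space M | S. S \<in> sets N}" for i
  have \<xi>: "\<xi> n \<in> measurable M N" for n
    using indep by (auto simp: indep_vars_def2)
  then have \<xi>_space: "\<xi> n \<in> space M \<rightarrow> space N" for n
    by (rule measurable_space[THEN funcsetI])
  have F_vimage: "F i = sets (vimage_algebra (space M) (\<xi> (int i)) N)" for i
    unfolding F_def by (rule sets_vimage_algebra2[symmetric, OF \<xi>_space])
  show "sigma_algebra (space M) (F i)" for i
    using sets.sigma_algebra_axioms[of "vimage_algebra (space M) (\<xi> (int i)) N"]
    by (simp add: F_vimage)
  show "indep_sets F UNIV"
  proof (rule indep_setsI)
    show "F i \<subseteq> events" for i
      using \<xi> by (auto simp: F_def)
    fix A :: "nat \<Rightarrow> 'a set" and J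
    assume J: "J \<noteq> {}" "finite J" "\<forall>j\<in>J. A j \<in> F j"
    have "indep_sets (\<lambda>n. {\<xi> n -` S \<inter> space M | S. S \<in> sets N}) UNIV"
      using indep by (simp add: indep_vars_def2)
    from indep_setsD[OF this, of "int ` J" "\<lambda>n. A (nat n)"] J
    show "prob (\<Inter>j\<in>J. A j) = (\<Prod>j\<in>J. prob (A j))"
      by (simp add: F_def prod.reindex inj_on_def)
  qed
  have step: "env_shift (Suc k) e \<in> E" if "env_shift k e \<in> E" for k e
    using shift[OF that] by (simp add: env_shift_def[abs_def] ac_simps)
  have later: "env_shift (k + m) e \<in> E" if "env_shift k e \<in> E" for k m e
    by (induction m) (use that step in auto)
  obtain c where c: "c \<in> space N"
    using not_empty \<xi>_space[of 0] by blast
  show "C \<in> tail_events F"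
    unfolding tail_events_def
  proof
    fix n :: nat
    let ?G = "\<Union>i\<in>{n..}. F i" and ?N = "sigma (space M) (\<Union>i\<in>{n..}. F i)"
    have G: "?G \<subseteq> Pow (space M)" by (auto simp: F_def)
    \<comment> \<open>Overwriting the coordinates below \<open>n\<close> by a constant makes the
      path measurable with respect to the coordinates from \<open>n\<close> on; by
      \<open>future\<close>, shifts by at least \<open>n\<close> do not notice the change.\<close>
    define g where "g \<omega> j = (if int n \<le> j then \<xi> j \<omega> else c)" for \<omega> j
    have "\<xi> j \<in> measurable ?N N" if "int n \<le> j" for j
    proof (rule measurableI)
      fix S assume "S \<in> sets N"
      then have "\<xi> j -` S \<inter> space M \<in> F (nat j)"
        using that by (auto simp: F_def)
      then show "\<xi> j -` S \<inter> space ?N \<in> sets ?N"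
        using that G by (auto simp: space_measure_of_conv intro!: in_measure_of sigma_sets.Basic bexI[of _ "nat j"])
    qed (use \<xi>_space in \<open>auto simp: space_measure_of_conv\<close>)
    then have "(\<lambda>\<omega>. g \<omega> j) \<in> measurable ?N N" for j
      using c by (cases "int n \<le> j") (simp_all add: g_def)
    then have g: "g \<in> measurable ?N (\<Pi>\<^sub>M n\<in>UNIV. N)"
      using c \<xi>_space by (intro measurable_PiM_single') (auto simp: g_def space_measure_of_conv Pi_iff)
    have "env_shift k (g \<omega>) \<in> E \<longleftrightarrow> env_shift k (\<lambda>n. \<xi> n \<omega>) \<in> E" if "n \<le> k" for k \<omega>
      by (rule iffI; erule future[rotated]) (use that in \<open>simp_all add: env_shift_def g_def\<close>)
    then have C: "C = {\<omega> \<in> space ?N. \<exists>k. n \<le> k \<and> env_shift k (g \<omega>) \<in> E}"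
      using later by (auto simp: C_def space_measure_of_conv) (metis le_add2)
    have "(\<lambda>\<omega>. env_shift k (g \<omega>)) \<in> measurable ?N (\<Pi>\<^sub>M n\<in>UNIV. N)" for k
      by (rule measurable_compose[OF g measurable_env_shift])
    note this[measurable] E[measurable]
    have "C \<in> sets ?N"
      unfolding C by measurable
    then show "C \<in> sigma_sets (space M) ?G"
      using G by simp
  qed
qed

text \<open>The completion appears because \<open>A\<close> is identified only up to a null set:
  where some offspring law charges 0, \<open>regular_process\<close> may involve unspecified values
  of \<open>h\<close>.\<close>

theorem theorem2p6:
  fixes M :: "'w measure"
    and \<xi> :: "int \<Rightarrow> 'w \<Rightarrow> nat pmf"
    and \<eta> :: "(int \<Rightarrow> nat pmf) measure"
    and A :: "(int \<Rightarrow> nat pmf) set"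
  assumes prob: "prob_space M"
    and indep: "prob_space.indep_vars M (\<lambda>_. offspring_space) \<xi> UNIV"
    and ident: "\<And>n. distr M offspring_space (\<xi> n) = distr M offspring_space (\<xi> 0)"
    and law: "\<eta> = distr M environment_space (\<lambda>\<omega> n. \<xi> n \<omega>)"
    and no_death: "\<P>(e in \<eta>. pmf (e 0) 0 = 0) = 1"
    and A: "A = {e \<in> space \<eta>. regular_process e}"
  shows "A \<in> sets (completion \<eta>) \<and>
    (measure (completion \<eta>) A = 0 \<or> measure (completion \<eta>) A = 1)"
proof -
  interpret prob_space M by (rule prob)
  let ?T = "\<lambda>\<omega> n. \<xi> n \<omega>"
  have \<xi>: "\<xi> n \<in> measurable M offspring_space" for n
    using indep by (auto simp: indep_vars_def2)
  have T[measurable]: "?T \<in> measurable M environment_space"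
    unfolding environment_space_def
    by (rule measurable_PiM_single') (auto simp: \<xi> space_offspring_space)
  have space_env: "space environment_space = UNIV"
    by (simp add: environment_space_def space_PiM space_offspring_space)
  have [simp]: "sets \<eta> = sets environment_space" "space \<eta> = UNIV"
    by (simp_all add: law space_env)
  interpret \<eta>: prob_space \<eta>
    unfolding law by (rule prob_space_distr) measurable
  \<comment> \<open>Only indices from 0 on enter, so that \<open>E\<close> depends on the
    nonnegative coordinates alone, as \<open>shift_0_1_law\<close> asks.\<close>
  define D where "D = {e :: int \<Rightarrow> nat pmf. \<forall>n. pmf (e (int n)) 0 = 0}"
  define E where "E = D \<inter> {e. pgf_regular e}"
  have D_sets[measurable]: "D \<in> sets environment_space"
  proof -
    have "{e \<in> space environment_space. \<forall>n. pmf (e (int n)) 0 = 0} \<in> sets environment_space"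
      by measurable
    then show ?thesis by (simp add: D_def space_env)
  qed
  have E_sets[measurable]: "E \<in> sets environment_space"
  proof -
    have "{e \<in> space environment_space. pgf_regular e} \<in> sets environment_space"
      by measurable
    then show ?thesis by (simp add: E_def space_env sets.Int)
  qed
  have "{e \<in> space environment_space. pmf (e 0) 0 = 0} \<in> sets environment_space"
    by measurable
  then have "AE e in \<eta>. pmf (e 0) 0 = 0"
    using no_death by (subst (asm) \<eta>.prob_Collect_eq_1) (simp_all add: space_env)
  then have "AE \<omega> in M. pmf (\<xi> 0 \<omega>) 0 = 0"
    unfolding law by (subst (asm) AE_distr_iff) simp_all
  \<comment> \<open>Passing to the law of a single coordinate lets \<open>ident\<close> carry the
    absence of mass at 0 from generation 0 to all others.\<close>
  then have "AE p in distr M offspring_space (\<xi> 0). pmf p 0 = 0"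
    using measurable_pmf_offspring_space by (subst AE_distr_iff[OF \<xi>]) simp_all
  then have "AE p in distr M offspring_space (\<xi> n). pmf p 0 = 0" for n
    by (subst ident)
  then have "AE \<omega> in M. pmf (\<xi> n \<omega>) 0 = 0" for n
    using measurable_pmf_offspring_space by (subst (asm) AE_distr_iff[OF \<xi>]) simp_all
  then have alive: "AE \<omega> in M. ?T \<omega> \<in> D"
    by (simp add: D_def AE_all_countable)
  then have D: "AE e in \<eta>. e \<in> D"
    unfolding law by (subst AE_distr_iff) simp_all
  have "A \<inter> D = E"
    using regular_process_iff by (auto simp: A D_def E_def)
  then have A_E: "AE e in completion \<eta>. e \<in> A \<longleftrightarrow> e \<in> E"
    using D by (intro AE_completion) auto
  have "- D \<in> null_sets \<eta>"
    using D D_sets sets.compl_sets[OF D_sets] AE_iff_null_sets[of "- D" \<eta>]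
    by (simp add: space_env Compl_eq_Diff_UNIV)
  have A_sets: "A \<in> sets (completion \<eta>)"
    by (rule sets_completionI[of A E "A - D" "- D"]) (use \<open>A \<inter> D = E\<close> \<open>- D \<in> null_sets \<eta>\<close> in auto)
  \<comment> \<open>The equivalence is confined to \<open>D\<close>: elsewhere \<open>e 0\<close>
    may charge 0 although the shifted environment lies in \<open>E\<close>.\<close>
  have shift_E: "env_shift 1 e \<in> E \<longleftrightarrow> e \<in> E" if "e \<in> D" for e
  proof -
    have "env_shift 1 e \<in> D" "pmf (e 0) 0 = 0"
      using that spec[of "\<lambda>n. pmf (e (int n)) 0 = 0"] by (auto simp: D_def env_shift_def) (metis of_nat_Suc add.commute, metis of_nat_0)
    then show ?thesis
      using that pgf_regular_env_shift[of e] by (simp add: E_def)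
  qed
  \<comment> \<open>Asking for some shift in \<open>E\<close> yields a genuine tail event. Almost
    surely all shifts lie in \<open>D\<close>, where \<open>shift_E\<close> makes this equivalent to
    the unshifted environment being in \<open>E\<close>.\<close>
  define C where "C = {\<omega> \<in> space M. \<exists>k. env_shift k (?T \<omega>) \<in> E}"
  have "prob C = 0 \<or> prob C = 1"
    unfolding C_def
  proof (rule shift_0_1_law[OF indep])
    show "E \<in> sets (\<Pi>\<^sub>M n\<in>UNIV. offspring_space)"
      using E_sets by (simp add: environment_space_def)
    show "env_shift 1 e \<in> E" if "e \<in> E" for e
      using that shift_E by (auto simp: E_def)
    fix e e' :: "int \<Rightarrow> nat pmf"
    assume eq: "\<And>n. 0 \<le> n \<Longrightarrow> e n = e' n" and "e \<in> E"
    have "pgf_iter n e s = pgf_iter n e' s" for n s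
      by (induction n arbitrary: s) (simp_all add: eq)
    then show "e' \<in> E"
      using \<open>e \<in> E\<close> by (simp add: E_def D_def eq pgf_regular_def)
  qed
  moreover have "measure (completion \<eta>) A = prob C"
  proof -
    have "measure (completion \<eta>) A = measure (completion \<eta>) E"
      by (rule measure_eq_AE[OF A_E A_sets]) simp
    also have "\<dots> = prob (?T -` E \<inter> space M)"
      by (simp add: law measure_distr)
    also have "\<dots> = prob C"
    proof (rule measure_eq_AE)
      show "AE \<omega> in M. \<omega> \<in> ?T -` E \<inter> space M \<longleftrightarrow> \<omega> \<in> C"
        using alive AE_space
      proof eventually_elim
        case (elim \<omega>)
        have D: "env_shift k (?T \<omega>) \<in> D" for k
          using elim by (auto simp: D_def env_shift_def) (metis of_nat_add)
        have "env_shift k (?T \<omega>) \<in> E \<longleftrightarrow> ?T \<omega> \<in> E" for k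
        proof (induction k)
          case (Suc k)
          have "env_shift (Suc k) (?T \<omega>) = env_shift 1 (env_shift k (?T \<omega>))"
            by (simp add: env_shift_def[abs_def] ac_simps)
          then show ?case using shift_E[OF D] Suc by simp
        qed (simp add: env_shift_def[abs_def])
        then show ?case using elim by (simp add: C_def)
      qed
      have "(\<lambda>\<omega>. env_shift k (?T \<omega>)) \<in> measurable M environment_space" for k
        using measurable_compose[OF T[unfolded environment_space_def] measurable_env_shift]
        by (simp add: environment_space_def)
      note this[measurable]
      show "C \<in> events" unfolding C_def by measurable
    qed measurable
    finally show ?thesis .
  qed
  ultimately show ?thesis using A_sets by simp
qed

end
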